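(* Let $F=5^{2a}\cdot Q^2$ be a friend of $10$, where $a$ is a positive integer and $Q$ is an odd positive integer coprime to $15$. Then $\sigma(5^{2a})+\sigma(Q^2)\equiv 2\pmod 8$ if and only if $a$ is odd.
   Context: For a positive integer $n$, $\sigma(n)$ denotes the sum of the positive divisors of $n$ and $I(n)=\sigma(n)/n$ is the abundancy index of $n$. Two distinct positive integers are friends of each other if they have the same abundancy index. Thus a friend of $10$ is a positive integer $F\neq 10$ with $I(F)=I(10)=9/5$, i.e. $5\sigma(F)=9F$. *)

theory Defs
  imports Complex_Main "HOL-Number_Theory.Cong"
begin

text \<open>
  All notions are meant for positive integers; at \<open>n = 0\<close> the divisor set is infinite, so
  \<open>divisor_sum 0 = 0\<close> by the convention for infinite sums.
\<close>

definition divisor_sum :: "nat \<Rightarrow> nat" where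
  "divisor_sum n = (\<Sum>d | d dvd n. d)"

definition abundancy_index :: "nat \<Rightarrow> rat" where
  "abundancy_index n = of_nat (divisor_sum n) / of_nat n"

definition friends :: "nat \<Rightarrow> nat \<Rightarrow> bool" where
  "friends m n \<longleftrightarrow> m > 0 \<and> n > 0 \<and> m \<noteq> n \<and> abundancy_index m = abundancy_index n"

end

(* Write A, B for the divisor sums of 5^(2a), Q^2.  Odd squares are 1 modulo 8, so
   5 A B = 9 * 5^(2a) * Q^2 gives 5 A B = 1, and A^2 = 1, hence B = 5 A and A + B = 6 A modulo 8.
   Since A = 1 + 6 a modulo 8, the sum is 6 + 36 a = 6 + 4 a modulo 8. *)
theory Submission
  imports Defs
begin

text \<open>Multiplication maps pairs of a divisor of \<open>m\<close> and a divisor of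
  \<open>n\<close> bijectively onto the divisors of \<open>m * n\<close>. By coprimality the inverse
  is \<open>d\<close> to \<open>(gcd d m, gcd d n)\<close>, so the product of the two sums reindexes
  to the sum over divisors of the product.\<close>

lemma divisor_sum_mult_coprime:
  assumes "coprime m n"
  shows "divisor_sum (m * n) = divisor_sum m * divisor_sum n"
proof -
  have gcd_left: "gcd (x * y) m = x" if "x dvd m" "y dvd n" for x y
  proof -
    have "coprime y m"
      using assms that(2) by (meson coprime_commute coprime_divisors dvd_refl)
    then show ?thesis
      using that(1) by (metis coprime_commute gcd_mult_left_right_cancel gcd_nat.absorb1)
  qed
  have gcd_right: "gcd (x * y) n = y" if "x dvd m" "y dvd n" for x y
  proof -
    have "coprime x n"
      using assms that(1) by (meson coprime_divisors dvd_refl)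
    then show ?thesis
      using that(2) by (metis coprime_commute gcd_mult_left_left_cancel gcd_nat.absorb1)
  qed
  have decomp: "gcd d m * gcd d n = d" if d: "d dvd m * n" for d
  proof -
    obtain x y where "d = x * y" "x dvd m" "y dvd n"
      using division_decomp[OF d] by blast
    then show ?thesis
      using gcd_left gcd_right by simp
  qed
  have "divisor_sum m * divisor_sum n = (\<Sum>(x, y)\<in>{x. x dvd m} \<times> {y. y dvd n}. x * y)"
    by (simp add: divisor_sum_def sum_product sum.cartesian_product)
  also have "\<dots> = (\<Sum>d | d dvd m * n. d)"
    by (rule sum.reindex_bij_witness[where i = "\<lambda>d. (gcd d m, gcd d n)" and j = "\<lambda>(x, y). x * y"])
      (auto simp: gcd_left gcd_right decomp mult_dvd_mono)
  finally show ?thesis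
    by (simp add: divisor_sum_def)
qed

lemma divisor_sum_prime_power:
  fixes p :: nat
  assumes "prime p"
  shows "divisor_sum (p ^ k) = (\<Sum>i\<le>k. p ^ i)"
proof -
  have "{d. d dvd p ^ k} = (\<lambda>i. p ^ i) ` {..k}"
    using assms by (auto simp: divides_primepow_nat)
  moreover have "inj_on (\<lambda>i. p ^ i) {..k}"
    using prime_gt_1_nat[OF assms] by (auto intro: inj_onI)
  ultimately show ?thesis
    by (simp add: divisor_sum_def sum.reindex)
qed

lemma odd_square_mod_8:
  fixes n :: nat
  assumes "odd n"
  shows "n\<^sup>2 mod 8 = 1"
proof -
  obtain k where "n = 2 * k + 1"
    using assms by (elim oddE)
  then have "n\<^sup>2 = 4 * (k * (k + 1)) + 1"
    by (simp add: power2_eq_square algebra_simps)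
  \<comment> \<open>One of two consecutive numbers is even, which raises the factor 4 to 8.\<close>
  moreover obtain j where "k * (k + 1) = 2 * j"
    by (metis dvdE even_mult_iff even_plus_one_iff)
  ultimately have "n\<^sup>2 = 8 * j + 1"
    by simp
  then show ?thesis
    by presburger
qed

text \<open>Raising \<open>a\<close> by one adds 5^(2a+1) + 5^(2a+2) = 30 * 25^a, which is 6 modulo
  8 because 25^a is an odd square and 30 is 6.\<close>

lemma sum_powers_of_5_cong: "[(\<Sum>i\<le>2 * a. (5 :: nat) ^ i) = 1 + 6 * a] (mod 8)"
proof (induction a)
  case (Suc a)
  have "[(25 :: nat) ^ a = 1] (mod 8)"
    using odd_square_mod_8[of "5 ^ a"]
    by (simp add: power2_eq_square cong_def flip: power_mult_distrib)
  moreover have "[30 = (6 :: nat)] (mod 8)"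
    by (simp add: cong_def)
  ultimately have "[(\<Sum>i\<le>2 * a. (5 :: nat) ^ i) + 30 * 25 ^ a = 1 + 6 * a + 6 * 1] (mod 8)"
    using Suc.IH by (intro cong_add cong_mult)
  moreover have "(\<Sum>i\<le>2 * Suc a. (5 :: nat) ^ i) = (\<Sum>i\<le>2 * a. 5 ^ i) + 30 * 25 ^ a"
    by (simp add: power_mult)
  ultimately show ?case
    by (simp add: algebra_simps)
qed simp

theorem theorem1p4:
  fixes F a Q :: nat
  assumes "friends F 10"
    and "F = 5 ^ (2 * a) * Q\<^sup>2"
    and "a > 0"
    and "Q > 0" and "odd Q" and "coprime Q 15"
  shows "[divisor_sum (5 ^ (2 * a)) + divisor_sum (Q\<^sup>2) = 2] (mod 8) \<longleftrightarrow> odd a"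
proof -
  define A B where "A = divisor_sum (5 ^ (2 * a))" and "B = divisor_sum (Q\<^sup>2)"
  have "coprime Q 5"
    using assms(6) coprime_divisors[of Q Q 5 15] by simp
  then have "coprime (5 ^ (2 * a)) (Q\<^sup>2)"
    by (simp add: coprime_commute)
  then have sigma_F: "divisor_sum F = A * B"
    by (simp add: assms(2) A_def B_def divisor_sum_mult_coprime)
  \<comment> \<open>The divisor sum of 10 is (1 + 2) * (1 + 5) = 18.\<close>
  have "coprime 2 (5 :: nat)"
    by simp
  then have "divisor_sum 10 = 18"
    using divisor_sum_mult_coprime[of 2 5] divisor_sum_prime_power[of 2 1]
      divisor_sum_prime_power[of 5 1] by simp
  then have "F > 0" and "rat_of_nat (divisor_sum F) / of_nat F = 18 / 10"
    using assms(1) by (simp_all only: friends_def abundancy_index_def of_nat_numeral)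
  \<comment> \<open>Since \<open>F > 0\<close>, the denominators can be cleared; the rational
    equation then transfers to the naturals.\<close>
  then have "rat_of_nat (5 * (A * B)) = of_nat (9 * F)"
    by (simp add: sigma_F field_simps)
  then have "5 * (A * B) = 9 * F"
    by (simp only: of_nat_eq_iff)
  \<comment> \<open>\<open>F\<close> is itself an odd square, hence 1 modulo 8.\<close>
  moreover have "F = (5 ^ a * Q)\<^sup>2"
    by (simp only: assms(2) power_mult_distrib mult.commute[of 2 a] power_mult)
  then have "[F = 1] (mod 8)"
    using odd_square_mod_8[of "5 ^ a * Q"] assms(5) by (simp add: cong_def)
  then have "[9 * F = 1 * 1] (mod 8)"
    by (intro cong_mult) (simp_all add: cong_def)
  ultimately have AB: "[5 * (A * B) = 1] (mod 8)"
    by (simp only: mult_1)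
  have A: "[A = 1 + 6 * a] (mod 8)"
    using sum_powers_of_5_cong by (simp add: A_def divisor_sum_prime_power)
  \<comment> \<open>Reducing to modulus 2 shows that \<open>A\<close> is odd, as 1 + 6a is.\<close>
  then have "[A = 1 + 6 * a] (mod 2)"
    by (rule cong_dvd_modulus_nat) simp
  then have "odd A"
    using cong_dvd_iff[of A "1 + 6 * a" 2] by simp
  then have "[A * A = 1] (mod 8)"
    using odd_square_mod_8 by (simp add: power2_eq_square cong_def)
  \<comment> \<open>To isolate \<open>B\<close>, the congruence \<open>AB\<close> is multiplied by
    \<open>5 * A\<close>: the factor 25 * A^2 in front of \<open>B\<close> is 1 modulo 8.\<close>
  then have "[25 * (A * A) * B = 1 * 1 * B] (mod 8)"
    by (intro cong_mult) (simp_all add: cong_def)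
  moreover have "[5 * A * (5 * (A * B)) = 5 * A * 1] (mod 8)"
    using AB by (intro cong_mult) simp_all
  moreover have "5 * A * (5 * (A * B)) = 25 * (A * A) * B"
    by simp
  ultimately have "[B = 5 * A] (mod 8)"
    by (metis cong_sym cong_trans mult_1 mult_1_right)
  then have "[A + B = A + 5 * A] (mod 8)"
    by (intro cong_add) simp_all
  also have "A + 5 * A = 6 * A"
    by simp
  also have "[6 * A = 6 * (1 + 6 * a)] (mod 8)"
    using A by (intro cong_mult) simp_all
  \<comment> \<open>The term 36a is split as 4a + 32a so that the multiple of 8 drops out.\<close>
  also have "6 * (1 + 6 * a) = 6 + 4 * a + 8 * (4 * a)"
    by simp
  finally have "[A + B = 2] (mod 8) \<longleftrightarrow> (6 + 4 * a) mod 8 = 2"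
    by (simp only: cong_def mod_mult_self2) simp
  \<comment> \<open>Modulo 8, 4a is 0 for even \<open>a\<close> and 4 for odd \<open>a\<close>, so
    the residue is 6 or 2 respectively.\<close>
  also have "\<dots> \<longleftrightarrow> odd a"
    by presburger
  finally show ?thesis
    by (simp add: A_def B_def)
qed

end
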